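(* Let $A$ be the dg-algebra of simplicial cochains over $\mathbb Z_2$ of the tetrahedral triangulation of $S^2$ (the boundary of the $3$-simplex with ordered vertices $0,1,2,3$), and let $$F:=F^{[012]}+F^{[013]}+F^{[023]}+F^{[123]},$$ with $F^{[ijl]}$ as defined in the context. Then $F$ is a homotopy inner product for $A$, i.e. $\mathcal D F=0$.
   Context: The ground ring is $\mathbb Z_2$, so signs are omitted. Differentials lower degree by one. $\underline A$ denotes $A$ shifted up by one, $\underline A_j=A_{j-1}$, and $A^*$ is the dual, $A^*_j=\mathrm{Hom}(A_{-j},\mathbb Z_2)$. **The operator $\mathcal D$ and homotopy inner products.** For a unital dg-algebra $A$ and a family $F=\{F_{p,q}:\underline A^{\otimes p}\otimes A\otimes\underline A^{\otimes q}\to A^*\}_{p,q\ge0}$ define $\mathcal D F$ as follows: $(\mathcal DF)_{p,q}(\underline{a_1},\dots,\underline{a_p};m;\underline{b_1},\dots,\underline{b_q})(n)$ is the sum of all terms obtained from $F_{p,q}(\underline{a_1},\dots,\underline{a_p};m;\underline{b_1},\dots,\underline{b_q})(n)$ by applying $d$ to exactly one of the inputs $a_1,\dots,a_p,m,b_1,\dots,b_q,n$, plus the following terms: if $p\ge1$, $F_{p-1,q}(\underline{a_2},\dots,\underline{a_p};m;\underline{b_1},\dots,\underline{b_q})(n a_1)$, $\sum_{j=1}^{p-1}F_{p-1,q}(\underline{a_1},\dots,\underline{a_ja_{j+1}},\dots,\underline{a_p};m;\underline{b_1},\dots,\underline{b_q})(n)$, $F_{p-1,q}(\underline{a_1},\dots,\underline{a_{p-1}};a_pm;\underline{b_1},\dots,\underline{b_q})(n)$;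 if $q\ge1$, $F_{p,q-1}(\underline{a_1},\dots,\underline{a_p};mb_1;\underline{b_2},\dots,\underline{b_q})(n)$, $\sum_{j=1}^{q-1}F_{p,q-1}(\underline{a_1},\dots,\underline{a_p};m;\underline{b_1},\dots,\underline{b_jb_{j+1}},\dots,\underline{b_q})(n)$, $F_{p,q-1}(\underline{a_1},\dots,\underline{a_p};m;\underline{b_1},\dots,\underline{b_{q-1}})(b_qn)$. $F$ is called a homotopy inner product for $A$ if $\mathcal DF=0$. **The algebra $A$.** Basis $e_j$ ($0\le j\le3$, degree $0$), $b_{ij}$ ($0\le i<j\le3$, degree $-1$), $c_{ijl}$ ($0\le i<j<l\le3$, degree $-2$); differential $d(e_j)=\sum_{i\ne j}b_{\{ij\}}$, $d(b_{ij})=\sum_{l\neq i,j}c_{\{ijl\}}$, $d(c_{ijl})=0$, where braces mean the indices are put in ascending order. Non-zero products of basis elements: $e_je_j=e_j$; $e_ib_{ij}=b_{ij}=b_{ij}e_j$; $e_ic_{ijl}=c_{ijl}=c_{ijl}e_l$; $b_{ij}b_{jl}=c_{ijl}$ (for $i<j<l$). The unit is $e_0+e_1+e_2+e_3$. **The maps $F^{[ijl]}$.** For $0\le i<j<l\le 3$, $F^{[ijl]}$ has only components with $q=0$, with only the following non-zero values on basis elements of $A$. For all $k\ge0$ (with $k$ copies of $\underline{b_{il}}$): $F_{k,0}(\underline{b_{il}},\dots,\underline{b_{il}};m)(n)=1$ for $(m,n)\in\{(c_{ijl},e_l),(e_i,c_{ijl}),(b_{ij},b_{jl})\}$. For all $k\ge0$,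 $1\le t\le k+1$, with $\underline{c_{ijl}}$ in the $t$-th of $k+1$ positions: $F_{k+1,0}(\underline{b_{ij}},\dots,\underline{b_{ij}},\underline{c_{ijl}},\underline{b_{il}},\dots,\underline{b_{il}};m)(n)=1$ for $(m,n)\in\{(e_i,b_{ij}),(b_{ij},e_j)\}$ and $F_{k+1,0}(\underline{b_{il}},\dots,\underline{b_{il}},\underline{c_{ijl}},\underline{b_{jl}},\dots,\underline{b_{jl}};m)(n)=1$ for $(m,n)\in\{(e_j,b_{jl}),(b_{jl},e_l)\}$. For all $k\ge0$, $1\le t_1<t_2\le k+2$, with $\underline{c_{ijl}}$ in positions $t_1$ and $t_2$ of $k+2$ positions: $F_{k+2,0}(\underline{b_{ij}},\dots,\underline{b_{ij}},\underline{c_{ijl}},\underline{b_{il}},\dots,\underline{b_{il}},\underline{c_{ijl}},\underline{b_{jl}},\dots,\underline{b_{jl}};e_j)(e_j)=1$. *)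

theory Defs
  imports Complex_Main "HOL-Library.Z2" "HOL-Library.Function_Algebras"
begin

section \<open>Unital dg-algebras over the field with two elements\<close>

text \<open>
  The ground field is \<^typ>\<open>bit\<close>. The algebra is a whole type, with ring structure given by its
  type class, and \<open>grade j\<close> is its homogeneous part of degree \<open>j\<close>. No signs are needed.
\<close>

locale unital_dg_algebra = vector_space scale
  for scale :: "bit \<Rightarrow> 'a::{ring, monoid_mult} \<Rightarrow> 'a" +
  fixes grade :: "int \<Rightarrow> 'a set"
    and d :: "'a \<Rightarrow> 'a"
  assumes scale_mult_left: "scale r x * y = scale r (x * y)"
    and scale_mult_right: "x * scale r y = scale r (x * y)"
    and subspace_grade: "subspace (grade j)"
    and direct_sum_grade:
      "\<exists>!f :: int \<Rightarrow> 'a. (\<forall>j. f j \<in> grade j) \<and> finite {j. f j \<noteq> 0} \<and> x = (\<Sum>j | f j \<noteq> 0. f j)"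
    and one_grade: "1 \<in> grade 0"
    and mult_grade: "x \<in> grade i \<Longrightarrow> y \<in> grade j \<Longrightarrow> x * y \<in> grade (i + j)"
    and linear_d: "Vector_Spaces.linear scale scale d"
    and d_grade: "x \<in> grade j \<Longrightarrow> d x \<in> grade (j - 1)"
    and d_d: "d (d x) = 0"
    and leibniz: "d (x * y) = d x * y + x * d y"
begin

text \<open>
  The dual is the graded one: a functional vanishes on all but finitely many homogeneous parts.
\<close>

definition graded_dual :: "('a \<Rightarrow> bit) set" where
  "graded_dual =
    {\<phi>. Vector_Spaces.linear scale (*) \<phi> \<and> finite {j. \<exists>x\<in>grade j. \<phi> x \<noteq> 0}}"

text \<open>
  A family of linear maps \<open>F\<^bsub>p,q\<^esub>\<close> from \<open>A\<^sup>\<otimes>\<^sup>p \<otimes> A \<otimes> A\<^sup>\<otimes>\<^sup>q\<close> to the dual of \<open>A\<close> is encoded as one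
  function of two lists: \<open>F as m bs n\<close> stands for
  \<open>F\<^bsub>p,q\<^esub>(a\<^sub>1, \<dots>, a\<^sub>p; m; b\<^sub>1, \<dots>, b\<^sub>q)(n)\<close>, where \<open>p\<close> and \<open>q\<close> are the lengths of \<open>as\<close> and \<open>bs\<close>.
  Maps out of a tensor product are multilinear maps. The degree shift of the outer tensor factors
  only changes the grading, hence leaves no trace in the absence of signs.
\<close>

definition map_family :: "('a list \<Rightarrow> 'a \<Rightarrow> 'a list \<Rightarrow> 'a \<Rightarrow> bit) \<Rightarrow> bool" where
  "map_family F \<longleftrightarrow>
    (\<forall>as m bs. F as m bs \<in> graded_dual) \<and>
    (\<forall>as m bs n. \<forall>i<length as. Vector_Spaces.linear scale (*) (\<lambda>x. F (as[i := x]) m bs n)) \<and>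
    (\<forall>as bs n. Vector_Spaces.linear scale (*) (\<lambda>x. F as x bs n)) \<and>
    (\<forall>as m bs n. \<forall>i<length bs. Vector_Spaces.linear scale (*) (\<lambda>x. F as m (bs[i := x]) n))"

text \<open>
  \<open>mult_at xs j\<close> replaces the two consecutive entries of \<open>xs\<close> at positions \<open>j\<close> and \<open>j + 1\<close>
  (counted from 0) by their product.
\<close>

definition mult_at :: "'a list \<Rightarrow> nat \<Rightarrow> 'a list" where
  "mult_at xs j = take j xs @ [xs ! j * xs ! Suc j] @ drop (j + 2) xs"

definition D :: "('a list \<Rightarrow> 'a \<Rightarrow> 'a list \<Rightarrow> 'a \<Rightarrow> bit) \<Rightarrow> 'a list \<Rightarrow> 'a \<Rightarrow> 'a list \<Rightarrow> 'a \<Rightarrow> bit" where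
  "D F as m bs n =
     (\<Sum>i<length as. F (as[i := d (as ! i)]) m bs n)
   + F as (d m) bs n
   + (\<Sum>i<length bs. F as m (bs[i := d (bs ! i)]) n)
   + F as m bs (d n)
   + (if as = [] then 0 else
        F (tl as) m bs (n * hd as)
      + (\<Sum>j<length as - 1. F (mult_at as j) m bs n)
      + F (butlast as) (last as * m) bs n)
   + (if bs = [] then 0 else
        F as (m * hd bs) (tl bs) n
      + (\<Sum>j<length bs - 1. F as m (mult_at bs j) n)
      + F as m (butlast bs) (last bs * n))"

definition homotopy_inner_product :: "('a list \<Rightarrow> 'a \<Rightarrow> 'a list \<Rightarrow> 'a \<Rightarrow> bit) \<Rightarrow> bool" where
  "homotopy_inner_product F \<longleftrightarrow> map_family F \<and> D F = 0"

end


section \<open>Simplicial cochains of the boundary of the 3-simplex\<close>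

definition simplices :: "nat set set" where
  "simplices = {\<sigma>. \<sigma> \<subseteq> {0..3} \<and> \<sigma> \<noteq> {} \<and> card \<sigma> \<le> 3}"

typedef cochain = "{f :: nat set \<Rightarrow> bit. \<forall>\<sigma>. \<sigma> \<notin> simplices \<longrightarrow> f \<sigma> = 0}"
  morphisms cochain_val Cochain
  by (rule exI[of _ "\<lambda>_. 0"]) simp

setup_lifting type_definition_cochain

text \<open>
  The product is the cup product: a simplex is split at each of its vertices \<open>v\<close> into its front
  face (up to \<open>v\<close>) and its back face (from \<open>v\<close> on).
\<close>

instantiation cochain :: "{zero, one, plus, minus, uminus, times}"
begin

lift_definition zero_cochain :: cochain is "\<lambda>\<sigma>. 0" by simp

lift_definition one_cochain :: cochain is "\<lambda>\<sigma>. of_bool (\<sigma> \<in> simplices \<and> card \<sigma> = 1)" by simp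

lift_definition plus_cochain :: "cochain \<Rightarrow> cochain \<Rightarrow> cochain" is "\<lambda>f g \<sigma>. f \<sigma> + g \<sigma>" by simp

lift_definition minus_cochain :: "cochain \<Rightarrow> cochain \<Rightarrow> cochain" is "\<lambda>f g \<sigma>. f \<sigma> - g \<sigma>" by simp

lift_definition uminus_cochain :: "cochain \<Rightarrow> cochain" is "\<lambda>f \<sigma>. - f \<sigma>" by simp

lift_definition times_cochain :: "cochain \<Rightarrow> cochain \<Rightarrow> cochain" is
  "\<lambda>f g \<sigma>. if \<sigma> \<in> simplices then \<Sum>v\<in>\<sigma>. f {u \<in> \<sigma>. u \<le> v} * g {u \<in> \<sigma>. v \<le> u} else 0" by simp

instance ..

end

lift_definition cochain_scale :: "bit \<Rightarrow> cochain \<Rightarrow> cochain" is "\<lambda>r f \<sigma>. r * f \<sigma>" by simp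

lift_definition cochain_d :: "cochain \<Rightarrow> cochain" is
  "\<lambda>f \<sigma>. if \<sigma> \<in> simplices then \<Sum>v\<in>\<sigma>. f (\<sigma> - {v}) else 0" by simp

text \<open>A \<open>k\<close>-cochain has degree \<open>-k\<close>, so that the differential lowers the degree.\<close>

definition cochain_grade :: "int \<Rightarrow> cochain set" where
  "cochain_grade j = {\<alpha>. \<forall>\<sigma>. cochain_val \<alpha> \<sigma> \<noteq> 0 \<longrightarrow> j = 1 - int (card \<sigma>)}"

lift_definition dual_cochain :: "nat set \<Rightarrow> cochain" is
  "\<lambda>\<sigma> \<tau>. of_bool (\<sigma> = \<tau> \<and> \<tau> \<in> simplices)" by auto

abbreviation e_elt :: "nat \<Rightarrow> cochain" where
  "e_elt j \<equiv> dual_cochain {j}"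

abbreviation b_elt :: "nat \<Rightarrow> nat \<Rightarrow> cochain" where
  "b_elt i j \<equiv> dual_cochain {i, j}"

abbreviation c_elt :: "nat \<Rightarrow> nat \<Rightarrow> nat \<Rightarrow> cochain" where
  "c_elt i j l \<equiv> dual_cochain {i, j, l}"

subsection \<open>The dg-algebra structure\<close>

lemma cochain_val_outside: "\<sigma> \<notin> simplices \<Longrightarrow> cochain_val \<alpha> \<sigma> = 0"
  using cochain_val[of \<alpha>] by auto

lemma cochain_val_empty [simp]: "cochain_val \<alpha> {} = 0"
  by (rule cochain_val_outside) (simp add: simplices_def)

lemma cochain_eqI: "(\<And>\<sigma>. \<sigma> \<in> simplices \<Longrightarrow> cochain_val \<alpha> \<sigma> = cochain_val \<beta> \<sigma>) \<Longrightarrow> \<alpha> = \<beta>"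
  by (metis cochain_val_inject cochain_val_outside ext)

lemmas cochain_val_simps =
  zero_cochain.rep_eq one_cochain.rep_eq plus_cochain.rep_eq minus_cochain.rep_eq
  uminus_cochain.rep_eq times_cochain.rep_eq cochain_scale.rep_eq cochain_d.rep_eq
  dual_cochain.rep_eq

lemma finite_simplices [simp]: "finite simplices"
  by (rule finite_subset[of _ "Pow {0..3}"]) (auto simp: simplices_def)

lemma simplices_finite: "\<sigma> \<in> simplices \<Longrightarrow> finite \<sigma>"
  unfolding simplices_def by (auto intro: finite_subset)

lemma vertex_simplex: "i \<le> 3 \<Longrightarrow> {i} \<in> simplices"
  by (simp add: simplices_def)

lemma edge_simplex: "i < j \<Longrightarrow> j \<le> 3 \<Longrightarrow> {i, j} \<in> simplices"
  by (simp add: simplices_def)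

lemma triangle_simplex: "i < j \<Longrightarrow> j < l \<Longrightarrow> l \<le> 3 \<Longrightarrow> {i, j, l} \<in> simplices"
  by (simp add: simplices_def)

lemma simplices_cases:
  assumes "\<sigma> \<in> simplices"
  obtains (vertex) i where "\<sigma> = {i}" "i \<le> 3"
    | (edge) i j where "\<sigma> = {i, j}" "i < j" "j \<le> 3"
    | (triangle) i j l where "\<sigma> = {i, j, l}" "i < j" "j < l" "l \<le> 3"
proof -
  define xs where "xs = sorted_list_of_set \<sigma>"
  have fin: "finite \<sigma>" by (rule simplices_finite[OF assms])
  then have set: "set xs = \<sigma>" and sorted: "sorted_wrt (<) xs" and len: "length xs = card \<sigma>"
    by (simp_all add: xs_def)
  have "card \<sigma> \<noteq> 0" "card \<sigma> \<le> 3" and le: "\<And>x. x \<in> \<sigma> \<Longrightarrow> x \<le> 3"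
    using assms fin by (auto simp: simplices_def)
  then have "length xs = 1 \<or> length xs = 2 \<or> length xs = 3"
    using len by linarith
  then consider i where "xs = [i]" | i j where "xs = [i, j]" | i j l where "xs = [i, j, l]"
    by (auto simp: length_Suc_conv numeral_2_eq_2 numeral_3_eq_3)
  then show thesis
  proof cases
    case 1
    then show thesis using set le by (intro vertex) auto
  next
    case (2 i j)
    then show thesis using set le sorted by (intro edge[of i j]) auto
  next
    case (3 i j l)
    then show thesis using set le sorted by (intro triangle[of i j l]) auto
  qed
qed

lemma sum_distinct:
  fixes f :: "'a \<Rightarrow> 'b::comm_monoid_add"
  shows "i \<noteq> j \<Longrightarrow> sum f {i, j} = f i + f j"
    and "i \<noteq> j \<Longrightarrow> j \<noteq> l \<Longrightarrow> i \<noteq> l \<Longrightarrow> sum f {i, j, l} = f i + (f j + f l)"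
  by simp_all

lemma times_vertex: "i \<le> 3 \<Longrightarrow> cochain_val (a * b) {i} = cochain_val a {i} * cochain_val b {i}"
proof -
  have "{u \<in> {i}. u \<le> i} = {i}" "{u \<in> {i}. i \<le> u} = {i}" by auto
  then show ?thesis if "i \<le> 3"
    using vertex_simplex[OF that] by (simp only: times_cochain.rep_eq) simp
qed

lemma times_edge:
  assumes "i < j" "j \<le> 3"
  shows "cochain_val (a * b) {i, j} =
    cochain_val a {i} * cochain_val b {i, j} + cochain_val a {i, j} * cochain_val b {j}"
proof -
  have "{u \<in> {i, j}. u \<le> i} = {i}" "{u \<in> {i, j}. i \<le> u} = {i, j}"
    "{u \<in> {i, j}. u \<le> j} = {i, j}" "{u \<in> {i, j}. j \<le> u} = {j}"
    using assms by auto
  moreover have "i \<noteq> j"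
    using assms by simp_all
  ultimately show ?thesis
    using edge_simplex[OF assms] by (simp only: times_cochain.rep_eq if_True sum_distinct add_ac
        not_False_eq_True)
qed

lemma times_triangle:
  assumes "i < j" "j < l" "l \<le> 3"
  shows "cochain_val (a * b) {i, j, l} =
    cochain_val a {i} * cochain_val b {i, j, l} + cochain_val a {i, j} * cochain_val b {j, l}
    + cochain_val a {i, j, l} * cochain_val b {l}"
proof -
  have "{u \<in> {i, j, l}. u \<le> i} = {i}" "{u \<in> {i, j, l}. i \<le> u} = {i, j, l}"
    "{u \<in> {i, j, l}. u \<le> j} = {i, j}" "{u \<in> {i, j, l}. j \<le> u} = {j, l}"
    "{u \<in> {i, j, l}. u \<le> l} = {i, j, l}" "{u \<in> {i, j, l}. l \<le> u} = {l}"
    using assms by auto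
  moreover have "i \<noteq> j" "j \<noteq> l" "i \<noteq> l"
    using assms by simp_all
  ultimately show ?thesis
    using triangle_simplex[OF assms] by (simp only: times_cochain.rep_eq if_True sum_distinct add_ac
        not_False_eq_True)
qed

lemma d_vertex: "cochain_val (cochain_d a) {i} = 0"
  by (simp add: cochain_d.rep_eq)

lemma d_edge:
  assumes "i < j" "j \<le> 3"
  shows "cochain_val (cochain_d a) {i, j} = cochain_val a {i} + cochain_val a {j}"
proof -
  have "{i, j} - {i} = {j}" "{i, j} - {j} = {i}" using assms by auto
  moreover have "i \<noteq> j"
    using assms by simp_all
  ultimately show ?thesis
    using edge_simplex[OF assms] by (simp only: cochain_d.rep_eq if_True sum_distinct add_ac
        not_False_eq_True)
qed

lemma d_triangle:
  assumes "i < j" "j < l" "l \<le> 3"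
  shows "cochain_val (cochain_d a) {i, j, l} =
    cochain_val a {i, j} + cochain_val a {i, l} + cochain_val a {j, l}"
proof -
  have "{i, j, l} - {i} = {j, l}" "{i, j, l} - {j} = {i, l}" "{i, j, l} - {l} = {i, j}"
    using assms by auto
  moreover have "i \<noteq> j" "j \<noteq> l" "i \<noteq> l"
    using assms by simp_all
  ultimately show ?thesis
    using triangle_simplex[OF assms] by (simp only: cochain_d.rep_eq if_True sum_distinct add_ac
        not_False_eq_True)
qed

lemma one_vertex: "i \<le> 3 \<Longrightarrow> cochain_val 1 {i} = 1"
  by (simp add: one_cochain.rep_eq vertex_simplex)

lemma one_edge: "i < j \<Longrightarrow> cochain_val 1 {i, j} = 0"
  by (simp add: one_cochain.rep_eq)

lemma one_triangle: "i < j \<Longrightarrow> j < l \<Longrightarrow> cochain_val 1 {i, j, l} = 0"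
  by (simp add: one_cochain.rep_eq)

lemma bit_add_self: "(a::bit) + a = 0"
  by (cases a) simp_all

lemma bit_add_self_left: "(a::bit) + (a + b) = b"
  by (cases a; cases b) simp_all

lemmas bit_distribs = distrib_left distrib_right add_ac mult.assoc

instance cochain :: ring_1
proof
  fix a b c :: cochain
  show "a * b * c = a * (b * c)"
  proof (rule cochain_eqI)
    fix \<sigma> assume "\<sigma> \<in> simplices"
    then show "cochain_val (a * b * c) \<sigma> = cochain_val (a * (b * c)) \<sigma>"
    proof (cases rule: simplices_cases)
      case (vertex i)
      then show ?thesis by (simp only: times_vertex mult.assoc)
    next
      case (edge i j)
      then have "i \<le> 3" by simp
      with edge show ?thesis
        by (simp only: times_vertex times_edge bit_distribs)
    next
      case (triangle i j l)
      then have "i \<le> 3" "j \<le> 3" "i < l" by simp_all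
      with triangle show ?thesis
        by (simp only: times_vertex times_edge times_triangle bit_distribs)
    qed
  qed
  show "1 * a = a"
  proof (rule cochain_eqI)
    fix \<sigma> assume "\<sigma> \<in> simplices"
    then show "cochain_val (1 * a) \<sigma> = cochain_val a \<sigma>"
      by (cases rule: simplices_cases)
        (simp_all add: times_vertex times_edge times_triangle one_vertex one_edge one_triangle)
  qed
  show "a * 1 = a"
  proof (rule cochain_eqI)
    fix \<sigma> assume "\<sigma> \<in> simplices"
    then show "cochain_val (a * 1) \<sigma> = cochain_val a \<sigma>"
      by (cases rule: simplices_cases)
        (simp_all add: times_vertex times_edge times_triangle one_vertex one_edge one_triangle)
  qed
  show "(a + b) * c = a * c + b * c"
    by (rule cochain_eqI)
      (simp only: plus_cochain.rep_eq times_cochain.rep_eq if_True distrib_right sum.distrib)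
  show "a * (b + c) = a * b + a * c"
    by (rule cochain_eqI)
      (simp only: plus_cochain.rep_eq times_cochain.rep_eq if_True distrib_left sum.distrib)
  have "cochain_val 0 {0} \<noteq> cochain_val 1 {0}"
    by (simp add: one_vertex zero_cochain.rep_eq)
  then show "(0::cochain) \<noteq> 1" by metis
qed (rule cochain_eqI, auto simp: zero_cochain.rep_eq plus_cochain.rep_eq minus_cochain.rep_eq
      uminus_cochain.rep_eq)+

lemma vector_space_cochain_scale: "vector_space cochain_scale"
  by standard (rule cochain_eqI, simp only: cochain_scale.rep_eq plus_cochain.rep_eq distrib_left
      distrib_right mult.assoc mult_1_left)+

lemma vector_space_bit: "vector_space ((*) :: bit \<Rightarrow> bit \<Rightarrow> bit)"
  by standard (simp_all only: distrib_left distrib_right mult.assoc mult_1_left)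

lemma cochain_val_sum: "cochain_val (\<Sum>x\<in>X. f x) \<sigma> = (\<Sum>x\<in>X. cochain_val (f x) \<sigma>)"
  by (induction X rule: infinite_finite_induct) (simp_all add: cochain_val_simps)

lemma cochain_val_grade:
  "\<alpha> \<in> cochain_grade j \<Longrightarrow> j \<noteq> 1 - int (card \<sigma>) \<Longrightarrow> cochain_val \<alpha> \<sigma> = 0"
  unfolding cochain_grade_def by blast

lemma cochain_decomposition:
  fixes x :: cochain
  shows "\<exists>!f. (\<forall>j. f j \<in> cochain_grade j) \<and> finite {j. f j \<noteq> 0} \<and> x = (\<Sum>j | f j \<noteq> 0. f j)"
proof -
  define g where
    "g j = Cochain (\<lambda>\<sigma>. if j = 1 - int (card \<sigma>) then cochain_val x \<sigma> else 0)" for j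
  have val_g: "cochain_val (g j) \<sigma> = (if j = 1 - int (card \<sigma>) then cochain_val x \<sigma> else 0)" for j \<sigma>
    unfolding g_def by (subst Cochain_inverse) (auto simp: cochain_val_outside)
  have graded: "g j \<in> cochain_grade j" for j
    by (simp add: cochain_grade_def val_g)
  have "{j. g j \<noteq> 0} \<subseteq> (\<lambda>\<sigma>. 1 - int (card \<sigma>)) ` simplices"
  proof
    fix j assume "j \<in> {j. g j \<noteq> 0}"
    then obtain \<sigma> where "\<sigma> \<in> simplices" "cochain_val (g j) \<sigma> \<noteq> 0"
      using cochain_eqI[of "g j" 0] by (metis mem_Collect_eq zero_cochain.rep_eq)
    then show "j \<in> (\<lambda>\<sigma>. 1 - int (card \<sigma>)) ` simplices"
      unfolding val_g by (metis image_eqI)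
  qed
  then have fin: "finite {j. g j \<noteq> 0}"
    by (rule finite_subset) simp
  have val_sum: "cochain_val (\<Sum>j | f j \<noteq> 0. f j) \<sigma> = cochain_val (f (1 - int (card \<sigma>))) \<sigma>"
    if "\<forall>j. f j \<in> cochain_grade j" "finite {j. f j \<noteq> 0}" for f \<sigma>
  proof -
    let ?k = "1 - int (card \<sigma>)"
    have "cochain_val (\<Sum>j | f j \<noteq> 0. f j) \<sigma> =
        (\<Sum>j | f j \<noteq> 0. if j = ?k then cochain_val (f j) \<sigma> else 0)"
      unfolding cochain_val_sum
    proof (rule sum.cong[OF refl])
      fix j
      show "cochain_val (f j) \<sigma> = (if j = ?k then cochain_val (f j) \<sigma> else 0)"
        using cochain_val_grade[of "f j" j \<sigma>] that(1) by (cases "j = ?k") simp_all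
    qed
    also have "\<dots> = (if f ?k \<noteq> 0 then cochain_val (f ?k) \<sigma> else 0)"
      using that(2) by (simp only: sum.delta mem_Collect_eq)
    also have "\<dots> = cochain_val (f ?k) \<sigma>"
      by (cases "f ?k = 0") (simp_all add: zero_cochain.rep_eq)
    finally show ?thesis .
  qed
  show ?thesis
  proof (rule ex1I[of _ g])
    have "x = (\<Sum>j | g j \<noteq> 0. g j)"
    proof (rule cochain_eqI)
      fix \<sigma>
      have "cochain_val (\<Sum>j | g j \<noteq> 0. g j) \<sigma> = cochain_val x \<sigma>"
        using val_sum[of g \<sigma>] graded fin val_g by simp
      then show "cochain_val x \<sigma> = cochain_val (\<Sum>j | g j \<noteq> 0. g j) \<sigma>"
        by (rule sym)
    qed
    then show "(\<forall>j. g j \<in> cochain_grade j) \<and> finite {j. g j \<noteq> 0} \<and> x = (\<Sum>j | g j \<noteq> 0. g j)"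
      using graded fin by blast
  next
    fix f
    assume f: "(\<forall>j. f j \<in> cochain_grade j) \<and> finite {j. f j \<noteq> 0} \<and> x = (\<Sum>j | f j \<noteq> 0. f j)"
    then have f_grade: "\<forall>j. f j \<in> cochain_grade j" and f_fin: "finite {j. f j \<noteq> 0}"
      and x: "x = (\<Sum>j | f j \<noteq> 0. f j)"
      by blast+
    show "f = g"
    proof (rule ext, rule cochain_eqI)
      fix j \<sigma>
      have "cochain_val x \<sigma> = cochain_val (f (1 - int (card \<sigma>))) \<sigma>"
        by (subst x) (rule val_sum[OF f_grade f_fin])
      then show "cochain_val (f j) \<sigma> = cochain_val (g j) \<sigma>"
        unfolding val_g using cochain_val_grade[OF f_grade[rule_format, of j], of \<sigma>]
        by (cases "j = 1 - int (card \<sigma>)") simp_all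
    qed
  qed
qed

lemma cochain_mult_grade:
  assumes "x \<in> cochain_grade i" "y \<in> cochain_grade j"
  shows "x * y \<in> cochain_grade (i + j)"
  unfolding cochain_grade_def
proof (intro CollectI allI impI)
  fix \<sigma> assume nz: "cochain_val (x * y) \<sigma> \<noteq> 0"
  then have \<sigma>: "\<sigma> \<in> simplices" using cochain_val_outside by blast
  then have "(\<Sum>v\<in>\<sigma>. cochain_val x {u \<in> \<sigma>. u \<le> v} * cochain_val y {u \<in> \<sigma>. v \<le> u}) \<noteq> 0"
    using nz by (simp only: times_cochain.rep_eq if_True not_False_eq_True)
  then obtain v where v: "v \<in> \<sigma>"
      "cochain_val x {u \<in> \<sigma>. u \<le> v} \<noteq> 0" "cochain_val y {u \<in> \<sigma>. v \<le> u} \<noteq> 0"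
    by (metis (no_types, lifting) sum.not_neutral_contains_not_neutral mult_eq_0_iff)
  have "card ({u \<in> \<sigma>. u \<le> v} \<union> {u \<in> \<sigma>. v \<le> u}) + card ({u \<in> \<sigma>. u \<le> v} \<inter> {u \<in> \<sigma>. v \<le> u})
      = card {u \<in> \<sigma>. u \<le> v} + card {u \<in> \<sigma>. v \<le> u}"
    using simplices_finite[OF \<sigma>] by (intro card_Un_Int[symmetric]) auto
  moreover have "{u \<in> \<sigma>. u \<le> v} \<union> {u \<in> \<sigma>. v \<le> u} = \<sigma>"
    and "{u \<in> \<sigma>. u \<le> v} \<inter> {u \<in> \<sigma>. v \<le> u} = {v}"
    using v(1) by auto
  moreover have "i = 1 - int (card {u \<in> \<sigma>. u \<le> v})" "j = 1 - int (card {u \<in> \<sigma>. v \<le> u})"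
    using assms v by (auto simp: cochain_grade_def)
  ultimately show "i + j = 1 - int (card \<sigma>)" by simp
qed

lemma cochain_d_grade:
  assumes "x \<in> cochain_grade j"
  shows "cochain_d x \<in> cochain_grade (j - 1)"
  unfolding cochain_grade_def
proof (intro CollectI allI impI)
  fix \<sigma> assume nz: "cochain_val (cochain_d x) \<sigma> \<noteq> 0"
  then have \<sigma>: "\<sigma> \<in> simplices" using cochain_val_outside by blast
  then have "(\<Sum>v\<in>\<sigma>. cochain_val x (\<sigma> - {v})) \<noteq> 0"
    using nz by (simp only: cochain_d.rep_eq if_True not_False_eq_True)
  then obtain v where v: "v \<in> \<sigma>" "cochain_val x (\<sigma> - {v}) \<noteq> 0"
    by (metis (no_types, lifting) sum.not_neutral_contains_not_neutral)
  then have "j = 1 - int (card (\<sigma> - {v}))"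
    using assms by (auto simp: cochain_grade_def)
  moreover have "card \<sigma> = Suc (card (\<sigma> - {v}))"
    by (rule card.remove[OF simplices_finite[OF \<sigma>] v(1)])
  ultimately show "j - 1 = 1 - int (card \<sigma>)" by simp
qed

interpretation tetrahedron: unital_dg_algebra cochain_scale cochain_grade cochain_d
proof -
  interpret vector_space cochain_scale by (rule vector_space_cochain_scale)
  show "unital_dg_algebra cochain_scale cochain_grade cochain_d"
  proof (intro unital_dg_algebra.intro unital_dg_algebra_axioms.intro vector_space_cochain_scale)
    fix r and x y :: cochain
    show "cochain_scale r x * y = cochain_scale r (x * y)"
      by (rule cochain_eqI)
        (simp only: cochain_scale.rep_eq times_cochain.rep_eq if_True sum_distrib_left mult.assoc)
    show "x * cochain_scale r y = cochain_scale r (x * y)"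
      by (rule cochain_eqI)
        (simp only: cochain_scale.rep_eq times_cochain.rep_eq if_True sum_distrib_left
          mult.left_commute)
    show "subspace (cochain_grade j)" for j
      by (auto simp: subspace_def cochain_grade_def cochain_val_simps)
    show "\<exists>!f. (\<forall>j. f j \<in> cochain_grade j) \<and> finite {j. f j \<noteq> 0} \<and> x = (\<Sum>j | f j \<noteq> 0. f j)"
      by (rule cochain_decomposition)
    show "1 \<in> cochain_grade 0"
      by (auto simp: cochain_grade_def cochain_val_simps)
    show "Vector_Spaces.linear cochain_scale cochain_scale cochain_d"
      by (intro Vector_Spaces.linear.intro module_hom.intro vector_space_cochain_scale module_axioms
          module_hom_axioms.intro; rule cochain_eqI)
        (simp_all only: cochain_d.rep_eq plus_cochain.rep_eq cochain_scale.rep_eq if_True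
          sum.distrib sum_distrib_left)
    show "cochain_d (cochain_d x) = 0"
    proof (rule cochain_eqI)
      fix \<sigma> assume "\<sigma> \<in> simplices"
      then show "cochain_val (cochain_d (cochain_d x)) \<sigma> = cochain_val 0 \<sigma>"
        unfolding zero_cochain.rep_eq
      proof (cases rule: simplices_cases)
        case (vertex i)
        then show "cochain_val (cochain_d (cochain_d x)) \<sigma> = 0"
          by (simp only: d_vertex)
      next
        case (edge i j)
        then show "cochain_val (cochain_d (cochain_d x)) \<sigma> = 0"
          by (simp only: d_vertex d_edge add_0_left)
      next
        case (triangle i j l)
        then have "j \<le> 3" "i < l" by simp_all
        with triangle show "cochain_val (cochain_d (cochain_d x)) \<sigma> = 0"
          by (simp only: d_edge d_triangle add_ac bit_add_self_left bit_add_self)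
      qed
    qed
    show "cochain_d (x * y) = cochain_d x * y + x * cochain_d y"
    proof (rule cochain_eqI)
      fix \<sigma> assume "\<sigma> \<in> simplices"
      then show "cochain_val (cochain_d (x * y)) \<sigma> =
          cochain_val (cochain_d x * y + x * cochain_d y) \<sigma>"
        unfolding plus_cochain.rep_eq
      proof (cases rule: simplices_cases)
        case (vertex i)
        then show "cochain_val (cochain_d (x * y)) \<sigma> =
            cochain_val (cochain_d x * y) \<sigma> + cochain_val (x * cochain_d y) \<sigma>"
          by (simp only: d_vertex times_vertex mult_zero_left mult_zero_right add_0_left)
      next
        case (edge i j)
        then have "i \<le> 3" by simp
        with edge show "cochain_val (cochain_d (x * y)) \<sigma> =
            cochain_val (cochain_d x * y) \<sigma> + cochain_val (x * cochain_d y) \<sigma>"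
          by (simp only: d_vertex d_edge times_vertex times_edge mult_zero_left mult_zero_right
              add_0_left add_0_right distrib_left distrib_right add_ac bit_add_self_left)
      next
        case (triangle i j l)
        then have "i \<le> 3" "j \<le> 3" "i < l" by simp_all
        with triangle show "cochain_val (cochain_d (x * y)) \<sigma> =
            cochain_val (cochain_d x * y) \<sigma> + cochain_val (x * cochain_d y) \<sigma>"
          by (simp only: d_vertex d_edge d_triangle times_edge times_triangle mult_zero_left
              mult_zero_right add_0_left add_0_right distrib_left distrib_right add_ac
              bit_add_self_left)
      qed
    qed
  qed (auto intro: cochain_mult_grade cochain_d_grade)
qed


subsection \<open>The structure constants\<close>

lemma cochain_basis_expansion: "\<alpha> = (\<Sum>\<sigma>\<in>simplices. cochain_scale (cochain_val \<alpha> \<sigma>) (dual_cochain \<sigma>))"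
proof (rule cochain_eqI)
  fix \<tau> assume \<tau>: "\<tau> \<in> simplices"
  have "cochain_val (\<Sum>\<sigma>\<in>simplices. cochain_scale (cochain_val \<alpha> \<sigma>) (dual_cochain \<sigma>)) \<tau>
      = (\<Sum>\<sigma>\<in>simplices. if \<sigma> = \<tau> then cochain_val \<alpha> \<sigma> else 0)"
    unfolding cochain_val_sum using \<tau>
    by (intro sum.cong) (auto simp: cochain_scale.rep_eq dual_cochain.rep_eq)
  also have "\<dots> = cochain_val \<alpha> \<tau>"
    using \<tau> by (simp only: sum.delta finite_simplices if_True)
  finally show "cochain_val \<alpha> \<tau> =
      cochain_val (\<Sum>\<sigma>\<in>simplices. cochain_scale (cochain_val \<alpha> \<sigma>) (dual_cochain \<sigma>)) \<tau>"
    by (rule sym)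
qed

lemma one_cochain_eq: "(1::cochain) = e_elt 0 + e_elt 1 + e_elt 2 + e_elt 3"
proof (rule cochain_eqI)
  fix \<sigma> assume "\<sigma> \<in> simplices"
  then show "cochain_val 1 \<sigma> = cochain_val (e_elt 0 + e_elt 1 + e_elt 2 + e_elt 3) \<sigma>"
  proof (cases rule: simplices_cases)
    case (vertex i)
    then have "i = 0 \<or> i = 1 \<or> i = 2 \<or> i = 3" by auto
    with vertex show ?thesis
      by (auto simp: one_vertex plus_cochain.rep_eq dual_cochain.rep_eq vertex_simplex)
  qed (auto simp: one_edge one_triangle plus_cochain.rep_eq dual_cochain.rep_eq)
qed

text \<open>
  In terms of the dual basis: \<open>d\<close> sums over all ways of adding a vertex, and the product joins two
  simplices at a common last and first vertex. The dual cochain of a non-simplex is 0.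
\<close>

lemma d_dual_cochain:
  assumes "\<sigma> \<in> simplices"
  shows "cochain_d (dual_cochain \<sigma>) = (\<Sum>v\<in>{0..3} - \<sigma>. dual_cochain (insert v \<sigma>))"
proof (rule cochain_eqI)
  fix \<tau> assume \<tau>: "\<tau> \<in> simplices"
  have "cochain_val (cochain_d (dual_cochain \<sigma>)) \<tau> =
      (\<Sum>v\<in>\<tau>. if \<sigma> = \<tau> - {v} then 1 else 0)"
    unfolding cochain_d.rep_eq dual_cochain.rep_eq using \<tau> assms
    by (simp only: if_True of_bool_def) (intro sum.cong, auto)
  also have "\<dots> = (\<Sum>v\<in>{0..3} - \<sigma>. if insert v \<sigma> = \<tau> then 1 else 0)"
  proof -
    have "\<tau> \<subseteq> {0..3}" "\<tau> \<noteq> {}" using \<tau> by (simp_all add: simplices_def)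
    then have "v \<in> \<tau> \<and> \<sigma> = \<tau> - {v} \<longleftrightarrow> v \<in> {0..3} - \<sigma> \<and> insert v \<sigma> = \<tau>" for v
      by blast
    then have "{v \<in> \<tau>. \<sigma> = \<tau> - {v}} = {v \<in> {0..3} - \<sigma>. insert v \<sigma> = \<tau>}"
      by (intro Collect_cong)
    then show ?thesis
      using simplices_finite[OF \<tau>]
      by (simp only: sum.inter_filter[symmetric] finite_Diff finite_atLeastAtMost)
  qed
  also have "\<dots> = cochain_val (\<Sum>v\<in>{0..3} - \<sigma>. dual_cochain (insert v \<sigma>)) \<tau>"
    unfolding cochain_val_sum dual_cochain.rep_eq using \<tau> by (intro sum.cong) auto
  finally show "cochain_val (cochain_d (dual_cochain \<sigma>)) \<tau> = \<dots>" .
qed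

lemma times_dual_cochain:
  assumes "\<sigma> \<in> simplices" "\<tau> \<in> simplices"
  shows "dual_cochain \<sigma> * dual_cochain \<tau> = (if Max \<sigma> = Min \<tau> then dual_cochain (\<sigma> \<union> \<tau>) else 0)"
proof (rule cochain_eqI)
  fix \<rho> assume \<rho>: "\<rho> \<in> simplices"
  have fin: "finite \<sigma>" "finite \<tau>" "finite \<rho>" and ne: "\<sigma> \<noteq> {}" "\<tau> \<noteq> {}"
    using assms \<rho> by (auto simp: simplices_finite) (auto simp: simplices_def)
  have iff: "\<sigma> = {u \<in> \<rho>. u \<le> v} \<and> \<tau> = {u \<in> \<rho>. v \<le> u} \<longleftrightarrow> v = Max \<sigma> \<and> Max \<sigma> = Min \<tau> \<and> \<rho> = \<sigma> \<union> \<tau>"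
    if "v \<in> \<rho>" for v
  proof
    assume eqs: "\<sigma> = {u \<in> \<rho>. u \<le> v} \<and> \<tau> = {u \<in> \<rho>. v \<le> u}"
    then have "Max \<sigma> = v" using that fin by (intro Max_eqI) auto
    moreover have "Min \<tau> = v" using that fin eqs by (intro Min_eqI) auto
    moreover have "\<rho> = \<sigma> \<union> \<tau>" using eqs by auto
    ultimately show "v = Max \<sigma> \<and> Max \<sigma> = Min \<tau> \<and> \<rho> = \<sigma> \<union> \<tau>" by simp
  next
    assume *: "v = Max \<sigma> \<and> Max \<sigma> = Min \<tau> \<and> \<rho> = \<sigma> \<union> \<tau>"
    have "v \<in> \<sigma>" using * Max_in[OF fin(1) ne(1)] by metis
    moreover have "v \<in> \<tau>" using * Min_in[OF fin(2) ne(2)] by metis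
    moreover have "u \<le> v" if "u \<in> \<sigma>" for u using * Max_ge[OF fin(1) that] by metis
    moreover have "v \<le> u" if "u \<in> \<tau>" for u using * Min_le[OF fin(2) that] by metis
    ultimately have "u \<in> \<sigma> \<longleftrightarrow> u \<in> \<rho> \<and> u \<le> v" "u \<in> \<tau> \<longleftrightarrow> u \<in> \<rho> \<and> v \<le> u" for u
      using * by (metis Un_iff antisym)+
    then show "\<sigma> = {u \<in> \<rho>. u \<le> v} \<and> \<tau> = {u \<in> \<rho>. v \<le> u}"
      by blast
  qed
  have absorb: "of_bool (\<sigma> = L \<and> L \<in> simplices) * of_bool (\<tau> = R \<and> R \<in> simplices) =
      (of_bool (\<sigma> = L \<and> \<tau> = R) :: bit)" for L R
    using assms by (cases "\<sigma> = L"; cases "\<tau> = R") simp_all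
  have "cochain_val (dual_cochain \<sigma> * dual_cochain \<tau>) \<rho> =
      (\<Sum>v\<in>\<rho>. if v = Max \<sigma> then of_bool (Max \<sigma> = Min \<tau> \<and> \<rho> = \<sigma> \<union> \<tau>) else 0)"
    unfolding times_cochain.rep_eq dual_cochain.rep_eq if_P[OF \<rho>]
  proof (rule sum.cong[OF refl])
    fix v assume v: "v \<in> \<rho>"
    have "of_bool (\<sigma> = {u \<in> \<rho>. u \<le> v} \<and> {u \<in> \<rho>. u \<le> v} \<in> simplices) *
        of_bool (\<tau> = {u \<in> \<rho>. v \<le> u} \<and> {u \<in> \<rho>. v \<le> u} \<in> simplices) =
        (of_bool (\<sigma> = {u \<in> \<rho>. u \<le> v} \<and> \<tau> = {u \<in> \<rho>. v \<le> u}) :: bit)"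
      by (rule absorb)
    also have "\<dots> = (if v = Max \<sigma> then of_bool (Max \<sigma> = Min \<tau> \<and> \<rho> = \<sigma> \<union> \<tau>) else 0)"
      unfolding iff[OF v] by (cases "v = Max \<sigma>") (simp_all only: simp_thms if_True if_False of_bool_eq)
    finally show "of_bool (\<sigma> = {u \<in> \<rho>. u \<le> v} \<and> {u \<in> \<rho>. u \<le> v} \<in> simplices) *
        of_bool (\<tau> = {u \<in> \<rho>. v \<le> u} \<and> {u \<in> \<rho>. v \<le> u} \<in> simplices) =
        (if v = Max \<sigma> then of_bool (Max \<sigma> = Min \<tau> \<and> \<rho> = \<sigma> \<union> \<tau>) else 0 :: bit)" .
  qed
  also have "\<dots> = (if Max \<sigma> \<in> \<rho> then of_bool (Max \<sigma> = Min \<tau> \<and> \<rho> = \<sigma> \<union> \<tau>) else 0)"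
    using fin(3) by (simp only: sum.delta)
  also have "\<dots> = of_bool (Max \<sigma> = Min \<tau> \<and> \<rho> = \<sigma> \<union> \<tau>)"
    using Max_in[OF fin(1) ne(1)] by (cases "\<rho> = \<sigma> \<union> \<tau>") simp_all
  also have "\<dots> = cochain_val (if Max \<sigma> = Min \<tau> then dual_cochain (\<sigma> \<union> \<tau>) else 0) \<rho>"
    using \<rho> by (cases "Max \<sigma> = Min \<tau>") (simp_all add: dual_cochain.rep_eq zero_cochain.rep_eq eq_commute)
  finally show "cochain_val (dual_cochain \<sigma> * dual_cochain \<tau>) \<rho> =
      cochain_val (if Max \<sigma> = Min \<tau> then dual_cochain (\<sigma> \<union> \<tau>) else 0) \<rho>" .
qed


section \<open>The maps attached to the triangles\<close>

text \<open>
  \<open>F_nonzero i j l as m n\<close> lists the basis elements on which the map of the triangle \<open>ijl\<close> takes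
  the value 1. The lengths \<open>r\<close>, \<open>s\<close>, \<open>u\<close> of the runs of equal arguments determine the number of
  arguments and the positions of the entries \<open>c\<^bsub>ijl\<^esub>\<close>.
\<close>

inductive F_nonzero :: "nat \<Rightarrow> nat \<Rightarrow> nat \<Rightarrow> cochain list \<Rightarrow> cochain \<Rightarrow> cochain \<Rightarrow> bool"
  for i j l where
  no_c:
    "(m, n) \<in> {(c_elt i j l, e_elt l), (e_elt i, c_elt i j l), (b_elt i j, b_elt j l)} \<Longrightarrow>
     F_nonzero i j l (replicate k (b_elt i l)) m n"
| one_c_left:
    "(m, n) \<in> {(e_elt i, b_elt i j), (b_elt i j, e_elt j)} \<Longrightarrow>
     F_nonzero i j l (replicate r (b_elt i j) @ [c_elt i j l] @ replicate s (b_elt i l)) m n"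
| one_c_right:
    "(m, n) \<in> {(e_elt j, b_elt j l), (b_elt j l, e_elt l)} \<Longrightarrow>
     F_nonzero i j l (replicate r (b_elt i l) @ [c_elt i j l] @ replicate s (b_elt j l)) m n"
| two_c:
    "F_nonzero i j l
       (replicate r (b_elt i j) @ [c_elt i j l] @ replicate s (b_elt i l) @ [c_elt i j l]
         @ replicate u (b_elt j l)) (e_elt j) (e_elt j)"

text \<open>The multilinear extension of these values, vanishing unless \<open>q = 0\<close>.\<close>

definition F_triangle ::
  "nat \<Rightarrow> nat \<Rightarrow> nat \<Rightarrow> cochain list \<Rightarrow> cochain \<Rightarrow> cochain list \<Rightarrow> cochain \<Rightarrow> bit" where
  "F_triangle i j l as m bs n =
    (if bs = [] then
       \<Sum>\<sigma>s | set \<sigma>s \<subseteq> simplices \<and> length \<sigma>s = length as. \<Sum>\<mu>\<in>simplices. \<Sum>\<nu>\<in>simplices.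
         (\<Prod>t<length as. cochain_val (as ! t) (\<sigma>s ! t)) * cochain_val m \<mu> * cochain_val n \<nu> *
         of_bool (F_nonzero i j l (map dual_cochain \<sigma>s) (dual_cochain \<mu>) (dual_cochain \<nu>))
     else 0)"

lemma F_triangle_dual_cochain:
  assumes "set \<sigma>s \<subseteq> simplices" "\<mu> \<in> simplices" "\<nu> \<in> simplices"
  shows "F_triangle i j l (map dual_cochain \<sigma>s) (dual_cochain \<mu>) [] (dual_cochain \<nu>) =
    of_bool (F_nonzero i j l (map dual_cochain \<sigma>s) (dual_cochain \<mu>) (dual_cochain \<nu>))"
proof -
  let ?V = "\<lambda>\<tau>s \<mu>' \<nu>'. of_bool (F_nonzero i j l (map dual_cochain \<tau>s) (dual_cochain \<mu>')
    (dual_cochain \<nu>')) :: bit"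
  let ?L = "{\<tau>s. set \<tau>s \<subseteq> simplices \<and> length \<tau>s = length \<sigma>s}"
  have val: "cochain_val (dual_cochain \<sigma>) \<tau> = of_bool (\<sigma> = \<tau>)" if "\<tau> \<in> simplices" for \<sigma> \<tau>
    using that by (simp add: dual_cochain.rep_eq)
  have prod: "(\<Prod>t<length \<sigma>s. cochain_val (map dual_cochain \<sigma>s ! t) (\<tau>s ! t)) = of_bool (\<tau>s = \<sigma>s)"
    if "\<tau>s \<in> ?L" for \<tau>s
  proof (cases "\<tau>s = \<sigma>s")
    case True
    then show ?thesis using assms(1) by (auto intro!: prod.neutral simp: val subset_iff)
  next
    case False
    with that obtain t where t: "t < length \<sigma>s" "\<sigma>s ! t \<noteq> \<tau>s ! t"
      by (metis (mono_tags, lifting) mem_Collect_eq nth_equalityI)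
    then have "cochain_val (map dual_cochain \<sigma>s ! t) (\<tau>s ! t) = 0"
      using that by (auto simp: dual_cochain.rep_eq)
    then have "(\<Prod>t<length \<sigma>s. cochain_val (map dual_cochain \<sigma>s ! t) (\<tau>s ! t)) = 0"
      using t(1) by (intro prod_zero) auto
    then show ?thesis using False by simp
  qed
  have inner: "(\<Sum>\<mu>'\<in>simplices. \<Sum>\<nu>'\<in>simplices. P * cochain_val (dual_cochain \<mu>) \<mu>' *
      cochain_val (dual_cochain \<nu>) \<nu>' * W \<mu>' \<nu>') = P * W \<mu> \<nu>" for P W
  proof -
    have "(\<Sum>\<mu>'\<in>simplices. \<Sum>\<nu>'\<in>simplices. P * cochain_val (dual_cochain \<mu>) \<mu>' *
        cochain_val (dual_cochain \<nu>) \<nu>' * W \<mu>' \<nu>')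
      = (\<Sum>\<mu>'\<in>simplices. if \<mu> = \<mu>' then \<Sum>\<nu>'\<in>simplices. if \<nu> = \<nu>' then P * W \<mu>' \<nu>' else 0 else 0)"
    proof (intro sum.cong refl)
      fix \<mu>' assume \<mu>': "\<mu>' \<in> simplices"
      show "(\<Sum>\<nu>'\<in>simplices. P * cochain_val (dual_cochain \<mu>) \<mu>' *
          cochain_val (dual_cochain \<nu>) \<nu>' * W \<mu>' \<nu>')
        = (if \<mu> = \<mu>' then \<Sum>\<nu>'\<in>simplices. if \<nu> = \<nu>' then P * W \<mu>' \<nu>' else 0 else 0)"
      proof (cases "\<mu> = \<mu>'")
        case True
        show ?thesis unfolding if_P[OF True]
          by (rule sum.cong[OF refl])
            (simp only: val True \<mu>' of_bool_def if_True mult_1_right mult_zero_right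
              mult_zero_left simp_thms split: if_split, blast)
      next
        case False
        show ?thesis unfolding if_not_P[OF False]
          by (rule sum.neutral)
            (simp only: val False \<mu>' of_bool_def if_False mult_zero_right mult_zero_left ball_triv
              simp_thms)
      qed
    qed
    then show ?thesis using assms(2,3) by (simp only: sum.delta' finite_simplices if_True)
  qed
  have "F_triangle i j l (map dual_cochain \<sigma>s) (dual_cochain \<mu>) [] (dual_cochain \<nu>) =
      (\<Sum>\<tau>s\<in>?L. (\<Prod>t<length \<sigma>s. cochain_val (map dual_cochain \<sigma>s ! t) (\<tau>s ! t)) * ?V \<tau>s \<mu> \<nu>)"
    unfolding F_triangle_def inner by (simp only: simp_thms if_True length_map)
  also have "\<dots> = (\<Sum>\<tau>s\<in>?L. if \<tau>s = \<sigma>s then ?V \<tau>s \<mu> \<nu> else 0)"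
    by (intro sum.cong refl) (simp only: prod, auto)
  also have "\<dots> = ?V \<sigma>s \<mu> \<nu>"
    using assms(1) finite_lists_length_eq[OF finite_simplices]
    by (simp only: sum.delta mem_Collect_eq simp_thms if_True)
  finally show ?thesis .
qed

end

theory Submission
  imports Defs
begin

text \<open>
  The value \<open>F\<^bsub>p,0\<^esub>(as; m)(n)\<close> of the map of a triangle depends on \<open>m\<close> and \<open>n\<close> only through
  \<open>m * n\<close>. This makes the terms of \<open>D F\<close> with \<open>q = 1\<close> cancel, and turns those with \<open>q = 0\<close> into a
  Hochschild boundary of the form \<open>(as, x) \<mapsto> F(as; 1)(x)\<close>. As a function of \<open>as\<close> this form is built
  from the entries of a product of bidiagonal \<open>3 \<times> 3\<close> matrices, one for each entry of \<open>as\<close>. A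
  simplex functional takes on \<open>a * b\<close> the sum over the splittings of the simplex, and on \<open>d a\<close> the
  sum over its faces; along the matrix product these contributions cancel each other except at the
  two ends. What is left of the Hochschild boundary is a sum of three forms, each attached to an
  edge of the triangle alone, and every edge of the tetrahedron lies in exactly two triangles.
\<close>

section \<open>Linear functionals on cochains\<close>

text \<open>The only scalars are 0 and 1, so additivity already gives linearity.\<close>

lemma linear_functionalI:
  assumes add: "\<And>x y. f (x + y) = f x + f y"
  shows "Vector_Spaces.linear cochain_scale (*) (f :: cochain \<Rightarrow> bit)"
proof -
  interpret B: vector_space "(*) :: bit \<Rightarrow> bit \<Rightarrow> bit" by (rule vector_space_bit)
  have "f 0 = 0" using add[of 0 0] by (metis add_0_left add_cancel_right_left)
  then have "f (cochain_scale r x) = r * f x" for r x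
    by (cases r) (simp_all only: tetrahedron.scale_zero_left tetrahedron.scale_one mult_zero_left mult_1_left)
  then show ?thesis
    by (intro Vector_Spaces.linear.intro module_hom.intro module_hom_axioms.intro
        vector_space_cochain_scale tetrahedron.module_axioms B.module_axioms vector_space_bit add)
qed

lemma additive_sum:
  assumes add: "\<And>x y. f (x + y) = f x + (f y :: bit)"
  shows "f (\<Sum>t\<in>T. g t) = (\<Sum>t\<in>T. f (g t :: cochain))"
proof -
  have "f 0 = 0" using add[of 0 0] by (metis add_0_left add_cancel_right_left)
  then show ?thesis by (induction T rule: infinite_finite_induct) (simp_all only: sum.infinite sum.empty sum.insert add not_False_eq_True)
qed

lemma functional_expansion:
  assumes add: "\<And>x y. f (x + y) = f x + (f y :: bit)"
  shows "f a = (\<Sum>\<sigma>\<in>simplices. cochain_val a \<sigma> * f (dual_cochain \<sigma>))"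
proof -
  interpret L: Vector_Spaces.linear cochain_scale "(*) :: bit \<Rightarrow> bit \<Rightarrow> bit" f
    by (rule linear_functionalI[OF add])
  show ?thesis
    by (subst cochain_basis_expansion[of a]) (simp only: additive_sum[of f, OF add] L.scale)
qed

text \<open>\<open>F_triangle\<close> is defined by such an expansion; comparing it with another
  multilinear form thus reduces to words of basis elements.\<close>

lemma multilinear_expansion:
  fixes \<Psi> :: "cochain list \<Rightarrow> bit"
  assumes "\<And>as :: cochain list. \<And>i x y. i < length as \<Longrightarrow> \<Psi> (as[i := x + y]) = \<Psi> (as[i := x]) + \<Psi> (as[i := y])"
  shows "\<Psi> as = (\<Sum>\<sigma>s | set \<sigma>s \<subseteq> simplices \<and> length \<sigma>s = length as.
    (\<Prod>t<length as. cochain_val (as ! t) (\<sigma>s ! t)) * \<Psi> (map dual_cochain \<sigma>s))"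
  using assms
proof (induction as arbitrary: \<Psi>)
  case Nil
  have "{\<sigma>s :: nat set list. set \<sigma>s \<subseteq> simplices \<and> length \<sigma>s = length ([] :: cochain list)} = {[]}"
    by auto
  then show ?case by (simp del: length_0_conv)
next
  case (Cons a as)
  let ?L = "\<lambda>as. {\<sigma>s. set \<sigma>s \<subseteq> simplices \<and> length \<sigma>s = length (as :: cochain list)}"
  let ?P = "\<lambda>as \<sigma>s. \<Prod>t<length as. cochain_val (as ! t) (\<sigma>s ! t)"
  have L: "?L (a # as) = (\<lambda>(\<sigma>, \<sigma>s). \<sigma> # \<sigma>s) ` (simplices \<times> ?L as)"
    by (auto simp: length_Suc_conv image_iff)
  have inj: "inj_on (\<lambda>(\<sigma>, \<sigma>s). \<sigma> # \<sigma>s) X" for X :: "(nat set \<times> nat set list) set"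
    by (auto simp: inj_on_def)
  have head: "\<Psi> (a # as) = (\<Sum>\<sigma>\<in>simplices. cochain_val a \<sigma> * \<Psi> (dual_cochain \<sigma> # as))"
  proof (rule functional_expansion[of "\<lambda>x. \<Psi> (x # as)"])
    fix x y :: cochain
    show "\<Psi> ((x + y) # as) = \<Psi> (x # as) + \<Psi> (y # as)"
      using Cons.prems[of 0 "a # as" x y] by simp
  qed
  have tail: "\<Psi> (c # as) = (\<Sum>\<sigma>s\<in>?L as. ?P as \<sigma>s * \<Psi> (c # map dual_cochain \<sigma>s))" for c
  proof (rule Cons.IH[of "\<lambda>xs. \<Psi> (c # xs)"])
    fix xs :: "cochain list" and i and x y :: cochain assume "i < length xs"
    then show "\<Psi> (c # xs[i := x + y]) = \<Psi> (c # xs[i := x]) + \<Psi> (c # xs[i := y])"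
      using Cons.prems[of "Suc i" "c # xs" x y] by simp
  qed
  have "\<Psi> (a # as) = (\<Sum>\<sigma>\<in>simplices. \<Sum>\<sigma>s\<in>?L as.
      cochain_val a \<sigma> * ?P as \<sigma>s * \<Psi> (map dual_cochain (\<sigma> # \<sigma>s)))"
    by (subst head, subst tail) (simp only: sum_distrib_left mult.assoc list.map)
  also have "\<dots> = (\<Sum>\<sigma>s\<in>?L (a # as). ?P (a # as) \<sigma>s * \<Psi> (map dual_cochain \<sigma>s))"
    unfolding L sum.reindex[OF inj] sum.cartesian_product
    by (intro sum.cong refl)
      (simp only: prod.lessThan_Suc_shift nth_Cons_0 nth_Cons_Suc list.size comp_def split_beta
        add_0_right add_Suc_right)
  finally show ?case .
qed


section \<open>Block sums\<close>

text \<open>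
  \<open>block_sum \<gamma> [\<beta>\<^sub>1, \<dots>, \<beta>\<^sub>r] as\<close> sums, over all words
  \<open>\<beta>\<^sub>1 \<dots> \<beta>\<^sub>1 \<gamma> \<beta>\<^sub>2 \<dots> \<beta>\<^sub>2 \<gamma> \<dots> \<gamma> \<beta>\<^sub>r \<dots> \<beta>\<^sub>r\<close> of the length of \<open>as\<close>, the product of the values of the
  entries of \<open>as\<close> on the letters; it is an entry of a product of bidiagonal matrices.
\<close>

fun block_sum :: "nat set \<Rightarrow> nat set list \<Rightarrow> cochain list \<Rightarrow> bit" where
  "block_sum \<gamma> [] as = 0"
| "block_sum \<gamma> (\<beta> # \<beta>s) [] = of_bool (\<beta>s = [])"
| "block_sum \<gamma> (\<beta> # \<beta>s) (a # as) =
    cochain_val a \<beta> * block_sum \<gamma> (\<beta> # \<beta>s) as + cochain_val a \<gamma> * block_sum \<gamma> \<beta>s as"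

text \<open>The recursion of \<open>block_sum\<close> removes the first letter; its mirror image is
  needed where the last entry of \<open>as\<close> acts.\<close>

lemma block_sum_snoc:
  "block_sum \<gamma> (\<beta>s @ [\<beta>]) (as @ [a]) =
    block_sum \<gamma> (\<beta>s @ [\<beta>]) as * cochain_val a \<beta> + block_sum \<gamma> \<beta>s as * cochain_val a \<gamma>"
proof (induction as arbitrary: \<beta>s)
  case Nil
  show ?case
    proof (cases \<beta>s)
    case (Cons \<beta>' \<beta>s')
    then show ?thesis by (cases \<beta>s') simp_all
  qed simp
next
  case (Cons x as)
  show ?case
  proof (cases \<beta>s)
    case Nil
    then show ?thesis using Cons.IH[of "[]"]
      by (simp only: append_Nil append_Cons block_sum.simps mult_zero_left mult_zero_right
          add_0_right mult.assoc)
  next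
    case (Cons \<beta>' \<beta>s')
    then show ?thesis using Cons.IH[of \<beta>s] Cons.IH[of \<beta>s']
      by (simp only: append_Cons block_sum.simps distrib_left distrib_right ac_simps)
  qed
qed

lemma block_sum_additive:
  "t < length as \<Longrightarrow> block_sum \<gamma> \<beta>s (as[t := x + y]) =
    block_sum \<gamma> \<beta>s (as[t := x]) + block_sum \<gamma> \<beta>s (as[t := y])"
proof (induction \<gamma> \<beta>s as arbitrary: t rule: block_sum.induct)
  case (3 \<gamma> \<beta> \<beta>s a as)
  show ?case
  proof (cases t)
    case 0
    then show ?thesis
      by (simp only: list_update_code block_sum.simps plus_cochain.rep_eq distrib_left distrib_right
          ac_simps)
  next
    case (Suc t')
    then show ?thesis using 3
      by (simp only: list_update_code block_sum.simps distrib_left ac_simps list.size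
          add_Suc_right add_0_right Suc_less_eq)
  qed
qed simp_all

lemma dual_cochain_inject:
  "\<sigma> \<in> simplices \<Longrightarrow> \<tau> \<in> simplices \<Longrightarrow> dual_cochain \<sigma> = dual_cochain \<tau> \<longleftrightarrow> \<sigma> = \<tau>"
  by (metis (full_types) dual_cochain.rep_eq of_bool_eq_iff)


section \<open>Hochschild boundaries of block sums\<close>

text \<open>Multiplying out and sorting puts equal summands next to each other, where they cancel in
  pairs.\<close>

lemmas mod_2_simps = distrib_left distrib_right ac_simps bit_add_self bit_add_self_left
  mult_zero_left mult_zero_right add_0_left add_0_right mult_1_left mult_1_right

text \<open>The dual of the differential of the bar construction: the terms of \<open>D\<close> that
  change the left arguments alone.\<close>

definition inner_terms :: "(cochain list \<Rightarrow> bit) \<Rightarrow> cochain list \<Rightarrow> bit" where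
  "inner_terms f as = (\<Sum>i<length as. f (as[i := cochain_d (as ! i)]))
    + (\<Sum>j<length as - 1. f (tetrahedron.mult_at as j))"

lemma inner_terms_singleton: "inner_terms f [a] = f [cochain_d a]"
  by (simp add: inner_terms_def)

lemma inner_terms_Cons_Cons:
  "inner_terms f (a # b # as) =
    f (cochain_d a # b # as) + f (a * b # as) + inner_terms (\<lambda>xs. f (a # xs)) (b # as)"
proof -
  have "tetrahedron.mult_at (a # b # as) 0 = a * b # as"
    "tetrahedron.mult_at (a # b # as) (Suc j) = a # tetrahedron.mult_at (b # as) j" for j
    by (simp_all add: tetrahedron.mult_at_def)
  moreover have "length (a # b # as) = Suc (length (b # as))"
    "length (a # b # as) - 1 = Suc (length (b # as) - 1)"
    by simp_all
  ultimately show ?thesis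
    unfolding inner_terms_def
    by (simp only: sum.lessThan_Suc_shift comp_def list_update_code nth_Cons_0 nth_Cons_Suc ac_simps)
qed

lemma inner_terms_linear:
  "inner_terms (\<lambda>xs. u * f xs + w * g xs) as = u * inner_terms f as + w * inner_terms g as"
  by (simp only: inner_terms_def sum.distrib sum_distrib_left distrib_left ac_simps)

lemma inner_terms_block_sum_Nil: "inner_terms (block_sum \<gamma> []) as = 0"
  by (simp only: inner_terms_def block_sum.simps sum.neutral_const add_0_left)

text \<open>The recursion of \<open>block_sum\<close> passes to \<open>inner_terms\<close>, up to
  the two terms in which the first entry is differentiated or multiplied. A product takes two
  entries, so the inductions below start from singletons.\<close>

lemma inner_terms_block_sum_Cons_Cons:
  "inner_terms (block_sum \<gamma> (\<beta> # \<beta>s)) (a # b # as) =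
    block_sum \<gamma> (\<beta> # \<beta>s) (cochain_d a # b # as) + block_sum \<gamma> (\<beta> # \<beta>s) (a * b # as)
    + (cochain_val a \<beta> * inner_terms (block_sum \<gamma> (\<beta> # \<beta>s)) (b # as)
      + cochain_val a \<gamma> * inner_terms (block_sum \<gamma> \<beta>s) (b # as))"
  unfolding inner_terms_Cons_Cons inner_terms_linear[symmetric] by simp

lemma butlast_Cons_Cons: "butlast (a # b # as) = a # butlast (b # as)"
  by simp

lemma last_Cons_Cons: "last (a # b # as) = last (b # as)"
  by simp

text \<open>The sum telescopes: a vertex produced by differentiating an entry is produced again by
  splitting a product at a neighbouring entry. Only \<open>q\<close> at the front and
  \<open>p\<close> at the rear have no such partner.\<close>

lemma inner_terms_edge:
  assumes "p < q" "q \<le> 3" "as \<noteq> []"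
  shows "inner_terms (block_sum \<gamma> [{p, q}]) as =
    cochain_val (hd as) {q} * block_sum \<gamma> [{p, q}] (tl as)
    + block_sum \<gamma> [{p, q}] (butlast as) * cochain_val (last as) {p}"
  using assms(3)
proof (induction as rule: induct_list012)
  case (2 a)
  show ?case
    by (simp only: inner_terms_singleton block_sum.simps d_edge[OF assms(1,2)] list.sel
        list.distinct butlast.simps last.simps if_True of_bool_eq simp_thms mod_2_simps)
next
  case (3 a b as)
  show ?case
    unfolding inner_terms_block_sum_Cons_Cons inner_terms_block_sum_Nil
      3(2)[OF list.distinct(2)] butlast_Cons_Cons last_Cons_Cons list.sel block_sum.simps
      d_edge[OF assms(1,2)] times_edge[OF assms(1,2)]
    by (simp only: mod_2_simps)
qed simp

lemma block_sum_singleton: "block_sum \<gamma> [\<beta>] as = (\<Prod>a\<leftarrow>as. cochain_val a \<beta>)"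
  by (induction as) (simp_all only: block_sum.simps list.map prod_list.Nil prod_list.Cons
      mult_zero_right add_0_right of_bool_eq simp_thms)

text \<open>The residue that the boundary of a triangle leaves at one of its edges; no other data of
  the triangle enter.\<close>

definition edge_form :: "nat set \<Rightarrow> cochain list \<Rightarrow> cochain \<Rightarrow> cochain list \<Rightarrow> cochain \<Rightarrow> bit" where
  "edge_form \<beta> as m bs n =
    (if bs = [] then (\<Prod>a\<leftarrow>as. cochain_val a \<beta>) * cochain_val (m * n) \<beta> else 0)"

section \<open>Block sums on words of basis elements\<close>

lemma dual_cochain_val: "\<tau> \<in> simplices \<Longrightarrow> cochain_val (dual_cochain \<sigma>) \<tau> = of_bool (\<sigma> = \<tau>)"
  by (simp add: dual_cochain.rep_eq)

lemma ex_nat_iff: "(\<exists>r::nat. P r) \<longleftrightarrow> P 0 \<or> (\<exists>r. P (Suc r))"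
  by (metis not0_implies_Suc)

text \<open>Modulo 2 a sum of truth values is a disjunction only if the alternatives exclude each
  other. Here the first letter decides: it continues the block or is the separator.\<close>

lemma of_bool_disjoint_sum:
  "\<beta> \<noteq> \<gamma> \<Longrightarrow> of_bool (\<sigma> = \<beta>) * of_bool P + of_bool (\<sigma> = \<gamma>) * of_bool Q =
    (of_bool (\<sigma> = \<beta> \<and> P \<or> \<sigma> = \<gamma> \<and> Q) :: bit)"
  by (cases "\<sigma> = \<beta>"; cases "\<sigma> = \<gamma>") simp_all

lemma block_sum_one_block:
  assumes "\<beta> \<in> simplices"
  shows "block_sum \<gamma> [\<beta>] (map dual_cochain \<sigma>s) = of_bool (\<exists>r. \<sigma>s = replicate r \<beta>)"
proof (induction \<sigma>s)
  case (Cons \<sigma> \<sigma>s)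
  have "(\<exists>r. \<sigma> # \<sigma>s = replicate r \<beta>) \<longleftrightarrow> \<sigma> = \<beta> \<and> (\<exists>r. \<sigma>s = replicate r \<beta>)"
    by (subst ex_nat_iff) simp
  then show ?case using Cons
    by (simp only: list.map block_sum.simps dual_cochain_val assms of_bool_conj mult_zero_right
        add_0_right)
qed simp

lemma block_sum_two_blocks:
  assumes "\<beta> \<in> simplices" "\<beta>' \<in> simplices" "\<gamma> \<in> simplices" "\<beta> \<noteq> \<gamma>"
  shows "block_sum \<gamma> [\<beta>, \<beta>'] (map dual_cochain \<sigma>s) =
    of_bool (\<exists>r s. \<sigma>s = replicate r \<beta> @ \<gamma> # replicate s \<beta>')"
proof (induction \<sigma>s)
  case (Cons \<sigma> \<sigma>s)
  have "(\<exists>r s. \<sigma> # \<sigma>s = replicate r \<beta> @ \<gamma> # replicate s \<beta>') \<longleftrightarrow>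
      \<sigma> = \<beta> \<and> (\<exists>r s. \<sigma>s = replicate r \<beta> @ \<gamma> # replicate s \<beta>') \<or>
      \<sigma> = \<gamma> \<and> (\<exists>s. \<sigma>s = replicate s \<beta>')"
    by (subst ex_nat_iff) auto
  then show ?case using Cons
    by (simp only: list.map block_sum.simps(3) block_sum_one_block dual_cochain_val assms
        of_bool_disjoint_sum not_False_eq_True)
qed simp

lemma block_sum_three_blocks:
  assumes "\<beta> \<in> simplices" "\<beta>' \<in> simplices" "\<beta>'' \<in> simplices" "\<gamma> \<in> simplices" "\<beta> \<noteq> \<gamma>" "\<beta>' \<noteq> \<gamma>"
  shows "block_sum \<gamma> [\<beta>, \<beta>', \<beta>''] (map dual_cochain \<sigma>s) =
    of_bool (\<exists>r s u. \<sigma>s = replicate r \<beta> @ \<gamma> # replicate s \<beta>' @ \<gamma> # replicate u \<beta>'')"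
proof (induction \<sigma>s)
  case (Cons \<sigma> \<sigma>s)
  have "(\<exists>r s u. \<sigma> # \<sigma>s = replicate r \<beta> @ \<gamma> # replicate s \<beta>' @ \<gamma> # replicate u \<beta>'') \<longleftrightarrow>
      \<sigma> = \<beta> \<and> (\<exists>r s u. \<sigma>s = replicate r \<beta> @ \<gamma> # replicate s \<beta>' @ \<gamma> # replicate u \<beta>'') \<or>
      \<sigma> = \<gamma> \<and> (\<exists>s u. \<sigma>s = replicate s \<beta>' @ \<gamma> # replicate u \<beta>'')"
    by (subst ex_nat_iff) auto
  then show ?case using Cons
    by (simp only: list.map block_sum.simps(3) block_sum_two_blocks dual_cochain_val assms
        of_bool_disjoint_sum not_False_eq_True)
qed simp

text \<open>The eight listed pairs are pairwise different, so at most one product on the right is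
  nonzero and nothing cancels modulo 2.\<close>

lemma of_bool_table:
  assumes "distinct [ei, ej, el, b, b', c]"
  shows "of_bool (P \<and> ((\<mu>, \<nu>) = (c, el) \<or> (\<mu>, \<nu>) = (ei, c) \<or> (\<mu>, \<nu>) = (b, b'))
      \<or> Q \<and> ((\<mu>, \<nu>) = (ei, b) \<or> (\<mu>, \<nu>) = (b, ej))
      \<or> R \<and> ((\<mu>, \<nu>) = (ej, b') \<or> (\<mu>, \<nu>) = (b', el))
      \<or> S \<and> (\<mu>, \<nu>) = (ej, ej)) =
    of_bool S * (of_bool (\<mu> = ej) * of_bool (\<nu> = ej))
    + of_bool Q * (of_bool (\<mu> = ei) * of_bool (\<nu> = b) + of_bool (\<mu> = b) * of_bool (\<nu> = ej))
    + of_bool R * (of_bool (\<mu> = ej) * of_bool (\<nu> = b') + of_bool (\<mu> = b') * of_bool (\<nu> = el))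
    + of_bool P * (of_bool (\<mu> = ei) * of_bool (\<nu> = c) + of_bool (\<mu> = b) * of_bool (\<nu> = b')
      + of_bool (\<mu> = c) * (of_bool (\<nu> = el) :: bit))"
proof -
  consider "\<mu> = ei" | "\<mu> = ej" | "\<mu> = b" | "\<mu> = b'" | "\<mu> = c"
    | "\<mu> \<notin> {ei, ej, b, b', c}" by blast
  then show ?thesis
  proof cases
    case 1
    then show ?thesis using assms by (cases "\<nu> = b"; cases "\<nu> = c") auto
  next
    case 2
    then show ?thesis using assms by (cases "\<nu> = ej"; cases "\<nu> = b'") auto
  next
    case 3
    then show ?thesis using assms by (cases "\<nu> = ej"; cases "\<nu> = b'") auto
  next
    case 4
    then show ?thesis using assms by (cases "\<nu> = el") auto
  next
    case 5
    then show ?thesis using assms by (cases "\<nu> = el") auto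
  next
    case 6
    then show ?thesis by simp
  qed
qed

section \<open>The cyclic form of a fixed triangle\<close>

context
  fixes i j l :: nat
  assumes ij: "i < j" and jl: "j < l" and l3: "l \<le> 3"
begin

lemma il: "i < l" and j3: "j \<le> 3" and i3: "i \<le> 3"
  using ij jl l3 by auto

abbreviation "M \<equiv> block_sum {i, j, l}"

lemmas simplex = vertex_simplex[OF i3] vertex_simplex[OF j3] vertex_simplex[OF l3]
  edge_simplex[OF ij j3] edge_simplex[OF il l3] edge_simplex[OF jl l3] triangle_simplex[OF ij jl l3]

lemmas structure_constants =
  d_edge[OF ij j3] d_edge[OF il l3] d_edge[OF jl l3] d_triangle[OF ij jl l3]
  times_edge[OF ij j3] times_edge[OF il l3] times_edge[OF jl l3] times_triangle[OF ij jl l3]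
  d_vertex times_vertex[OF i3] times_vertex[OF j3] times_vertex[OF l3]

text \<open>Vertices telescope as for an edge. The faces {i, j} and {i, l} of the separator yield
  every mixed word twice, which leaves the two pure words. The face {j, l} cancels against the
  splitting of {i, j, l} at j, except in first position.\<close>

lemma inner_terms_left:
  assumes "as \<noteq> []"
  shows "inner_terms (M [{i, j}, {i, l}]) as =
    cochain_val (hd as) {j} * M [{i, j}, {i, l}] (tl as)
    + M [{i, j}, {i, l}] (butlast as) * cochain_val (last as) {i}
    + M [{i, j}] as + M [{i, l}] as + cochain_val (hd as) {j, l} * M [{i, l}] (tl as)"
  using assms
proof (induction as rule: induct_list012)
  case (2 a)
  show ?case
    by (simp only: inner_terms_singleton block_sum.simps structure_constants list.sel
        list.distinct butlast.simps last.simps if_True of_bool_eq simp_thms mod_2_simps)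
next
  case (3 a b as)
  show ?case
    unfolding inner_terms_block_sum_Cons_Cons inner_terms_edge[OF il l3 list.distinct(2)]
      3(2)[OF list.distinct(2)] butlast_Cons_Cons last_Cons_Cons list.sel block_sum.simps
      structure_constants
    by (simp only: mod_2_simps)
qed simp

text \<open>The mirror image of \<open>inner_terms_left\<close>: words are reversed and i and l
  exchanged.\<close>

lemma inner_terms_right:
  assumes "as \<noteq> []"
  shows "inner_terms (M [{i, l}, {j, l}]) as =
    cochain_val (hd as) {l} * M [{i, l}, {j, l}] (tl as)
    + M [{i, l}, {j, l}] (butlast as) * cochain_val (last as) {j}
    + M [{i, l}] as + M [{j, l}] as + M [{i, l}] (butlast as) * cochain_val (last as) {i, j}"
  using assms
proof (induction as rule: induct_list012)
  case (2 a)
  show ?case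
    by (simp only: inner_terms_singleton block_sum.simps structure_constants list.sel
        list.distinct butlast.simps last.simps if_True of_bool_eq simp_thms mod_2_simps)
next
  case (3 a b as)
  show ?case
    unfolding inner_terms_block_sum_Cons_Cons inner_terms_edge[OF jl l3 list.distinct(2)]
      3(2)[OF list.distinct(2)] butlast_Cons_Cons last_Cons_Cons list.sel block_sum.simps
      structure_constants
    by (simp only: mod_2_simps)
qed simp

text \<open>Both separators behave as in the two preceding lemmas. Words with an empty middle block
  arise from either one and cancel, except at the extremes, which complete the two-block sums on the
  right.\<close>

lemma inner_terms_both:
  assumes "as \<noteq> []"
  shows "inner_terms (M [{i, j}, {i, l}, {j, l}]) as =
    cochain_val (hd as) {j} * M [{i, j}, {i, l}, {j, l}] (tl as)
    + M [{i, j}, {i, l}, {j, l}] (butlast as) * cochain_val (last as) {j}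
    + M [{i, j}, {i, l}] as + M [{i, l}, {j, l}] as
    + cochain_val (hd as) {j, l} * M [{i, l}, {j, l}] (tl as)
    + M [{i, j}, {i, l}] (butlast as) * cochain_val (last as) {i, j}"
  using assms
proof (induction as rule: induct_list012)
  case (2 a)
  show ?case
    by (simp only: inner_terms_singleton block_sum.simps structure_constants list.sel
        list.distinct butlast.simps last.simps if_True of_bool_eq simp_thms mod_2_simps)
next
  case (3 a b as)
  show ?case
    unfolding inner_terms_block_sum_Cons_Cons inner_terms_right[OF list.distinct(2)]
      3(2)[OF list.distinct(2)] butlast_Cons_Cons last_Cons_Cons list.sel block_sum.simps
      structure_constants
    by (simp only: mod_2_simps)
qed simp

text \<open>The formula for F(as; 1)(x). Each simplex at which \<open>x\<close> is evaluated indexes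
  the common product of the pairs (m, n) in one clause of \<open>F_nonzero\<close>.\<close>

definition cyclic_form :: "cochain list \<Rightarrow> cochain \<Rightarrow> bit" where
  "cyclic_form as x =
    M [{i, j}, {i, l}, {j, l}] as * cochain_val x {j} + M [{i, j}, {i, l}] as * cochain_val x {i, j}
    + M [{i, l}, {j, l}] as * cochain_val x {j, l} + M [{i, l}] as * cochain_val x {i, j, l}"

lemma cyclic_form_add: "cyclic_form as (x + y) = cyclic_form as x + cyclic_form as y"
  by (simp only: cyclic_form_def plus_cochain.rep_eq distrib_left distrib_right ac_simps)

lemma cyclic_form_add_list:
  "t < length as \<Longrightarrow>
    cyclic_form (as[t := x + y]) z = cyclic_form (as[t := x]) z + cyclic_form (as[t := y]) z"
  by (simp only: cyclic_form_def block_sum_additive distrib_left distrib_right ac_simps)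

lemma inner_terms_cyclic_form:
  "inner_terms (\<lambda>as. cyclic_form as x) as =
    inner_terms (M [{i, j}, {i, l}, {j, l}]) as * cochain_val x {j}
    + inner_terms (M [{i, j}, {i, l}]) as * cochain_val x {i, j}
    + inner_terms (M [{i, l}, {j, l}]) as * cochain_val x {j, l}
    + inner_terms (M [{i, l}]) as * cochain_val x {i, j, l}"
  by (simp only: inner_terms_def cyclic_form_def sum.distrib sum_distrib_right distrib_right add_ac)

lemma hochschild_boundary_cyclic_form:
  assumes "as \<noteq> []"
  shows "inner_terms (\<lambda>as. cyclic_form as x) as + cyclic_form as (cochain_d x)
      + (cyclic_form (tl as) (x * hd as) + cyclic_form (butlast as) (last as * x)) =
    M [{i, j}] as * cochain_val x {i, j} + M [{i, l}] as * cochain_val x {i, l}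
    + M [{j, l}] as * cochain_val x {j, l}"
proof -
  \<comment> \<open>The values of \<open>x\<close> at i and l carry coefficients over
    \<open>as\<close> in the term with \<open>cochain_d x\<close>, but over \<open>tl as\<close> or
    \<open>butlast as\<close> in the cyclic terms. These expansions make them comparable.\<close>
  have front: "M [{i, j}, {i, l}] as = cochain_val (hd as) {i, j} * M [{i, j}, {i, l}] (tl as)
      + cochain_val (hd as) {i, j, l} * M [{i, l}] (tl as)"
  proof (cases as)
    case (Cons a as')
    then show ?thesis by (simp only: block_sum.simps list.sel)
  qed (simp add: assms)
  have rear: "M [{i, l}, {j, l}] as = M [{i, l}, {j, l}] (butlast as) * cochain_val (last as) {j, l}
      + M [{i, l}] (butlast as) * cochain_val (last as) {i, j, l}"
    using block_sum_snoc[of _ "[{i, l}]" "{j, l}" "butlast as" "last as"]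
    by (simp only: append_butlast_last_id[OF assms] append_Cons append_Nil)
  show ?thesis
    unfolding inner_terms_cyclic_form inner_terms_both[OF assms] inner_terms_left[OF assms]
      inner_terms_right[OF assms] inner_terms_edge[OF il l3 assms]
    unfolding cyclic_form_def structure_constants front rear
    by (simp only: mod_2_simps)
qed

text \<open>The case p = 0 of the boundary formula, where only the term with
  \<open>cochain_d x\<close> occurs.\<close>

lemma cyclic_form_Nil_d:
  "cyclic_form [] (cochain_d x) = cochain_val x {i, j} + cochain_val x {i, l} + cochain_val x {j, l}"
  by (simp only: cyclic_form_def block_sum.simps of_bool_eq structure_constants list.distinct
      simp_thms mod_2_simps)

section \<open>Comparison with the given maps\<close>

lemma F_nonzero_dual_cochain:
  assumes \<sigma>s: "set \<sigma>s \<subseteq> simplices" and \<mu>: "\<mu> \<in> simplices" and \<nu>: "\<nu> \<in> simplices"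
  shows "F_nonzero i j l (map dual_cochain \<sigma>s) (dual_cochain \<mu>) (dual_cochain \<nu>) \<longleftrightarrow>
    (\<exists>k. \<sigma>s = replicate k {i, l}) \<and>
      ((\<mu>, \<nu>) = ({i, j, l}, {l}) \<or> (\<mu>, \<nu>) = ({i}, {i, j, l}) \<or> (\<mu>, \<nu>) = ({i, j}, {j, l}))
    \<or> (\<exists>r s. \<sigma>s = replicate r {i, j} @ {i, j, l} # replicate s {i, l}) \<and>
      ((\<mu>, \<nu>) = ({i}, {i, j}) \<or> (\<mu>, \<nu>) = ({i, j}, {j}))
    \<or> (\<exists>r s. \<sigma>s = replicate r {i, l} @ {i, j, l} # replicate s {j, l}) \<and>
      ((\<mu>, \<nu>) = ({j}, {j, l}) \<or> (\<mu>, \<nu>) = ({j, l}, {l}))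
    \<or> (\<exists>r s u. \<sigma>s = replicate r {i, j} @ {i, j, l} # replicate s {i, l} @ {i, j, l} # replicate u {j, l})
      \<and> (\<mu>, \<nu>) = ({j}, {j})"
proof -
  \<comment> \<open>Non-simplices all have dual cochain 0, so words can be compared letter by letter
    only within \<open>simplices\<close>.\<close>
  have inj: "map dual_cochain \<sigma>s = map dual_cochain \<tau>s \<longleftrightarrow> \<sigma>s = \<tau>s" if "set \<tau>s \<subseteq> simplices" for \<tau>s
    using \<sigma>s that by (intro inj_on_map_eq_map inj_onI) (meson Un_iff dual_cochain_inject subset_iff)
  note word = inj[of "replicate _ _", unfolded map_replicate]
    inj[of "replicate _ _ @ _ # replicate _ _",
      unfolded map_append list.map map_replicate]
    inj[of "replicate _ _ @ _ # replicate _ _ @ _ # replicate _ _",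
      unfolded map_append list.map map_replicate]
  show ?thesis
    unfolding F_nonzero.simps[of i j l "map dual_cochain \<sigma>s"] append_Cons append_Nil
    using simplex
    by (simp add: word set_replicate_conv_if dual_cochain_inject \<mu> \<nu>)
qed

text \<open>The pairs in each clause are all factorizations of one basis element: c for words
  without separator, an edge for one separator, the vertex j for two. Hence only the product
  matters.\<close>

lemma of_bool_F_nonzero:
  assumes \<sigma>s: "set \<sigma>s \<subseteq> simplices" and \<mu>: "\<mu> \<in> simplices" and \<nu>: "\<nu> \<in> simplices"
  shows "of_bool (F_nonzero i j l (map dual_cochain \<sigma>s) (dual_cochain \<mu>) (dual_cochain \<nu>)) =
    cyclic_form (map dual_cochain \<sigma>s) (dual_cochain \<mu> * dual_cochain \<nu>)"
proof -
  have neq: "i \<noteq> j" "j \<noteq> l" "i \<noteq> l"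
    using ij jl by auto
  then have ne: "{i, j} \<noteq> {i, j, l}" "{i, l} \<noteq> {i, j, l}" "{j, l} \<noteq> {i, j, l}"
    by (metis insertCI insertE singletonD)+
  have dist: "distinct [{i}, {j}, {l}, {i, j}, {j, l}, {i, j, l}]"
    using neq ne by (auto simp: doubleton_eq_iff)
  note vals = dual_cochain_val[OF simplex(1)] dual_cochain_val[OF simplex(2)]
    dual_cochain_val[OF simplex(3)] dual_cochain_val[OF simplex(4)] dual_cochain_val[OF simplex(5)]
    dual_cochain_val[OF simplex(6)] dual_cochain_val[OF simplex(7)]
  show ?thesis
    unfolding F_nonzero_dual_cochain[OF assms] cyclic_form_def structure_constants vals
      block_sum_one_block[OF simplex(5)] block_sum_two_blocks[OF simplex(4) simplex(5) simplex(7) ne(1)]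
      block_sum_two_blocks[OF simplex(5) simplex(6) simplex(7) ne(2)]
      block_sum_three_blocks[OF simplex(4) simplex(5) simplex(6) simplex(7) ne(1,2)]
    by (rule of_bool_table[OF dist])
qed

text \<open>Both sides are multilinear and agree on basis elements; the right side is expanded in
  \<open>m\<close>, \<open>n\<close> and \<open>as\<close> in turn.\<close>

lemma F_triangle_eq_cyclic_form:
  "F_triangle i j l as m bs n = (if bs = [] then cyclic_form as (m * n) else 0)"
proof (cases "bs = []")
  case True
  let ?L = "{\<sigma>s. set \<sigma>s \<subseteq> simplices \<and> length \<sigma>s = length as}"
  let ?P = "\<lambda>\<sigma>s. \<Prod>t<length as. cochain_val (as ! t) (\<sigma>s ! t)"
  have "F_triangle i j l as m bs n = (\<Sum>\<sigma>s\<in>?L. \<Sum>\<mu>\<in>simplices. \<Sum>\<nu>\<in>simplices.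
      ?P \<sigma>s * (cochain_val m \<mu> * (cochain_val n \<nu> *
        cyclic_form (map dual_cochain \<sigma>s) (dual_cochain \<mu> * dual_cochain \<nu>))))"
    unfolding F_triangle_def if_P[OF True]
    by (intro sum.cong refl) (simp only: of_bool_F_nonzero mem_Collect_eq mult.assoc)
  also have "\<dots> = (\<Sum>\<sigma>s\<in>?L. ?P \<sigma>s * cyclic_form (map dual_cochain \<sigma>s) (m * n))"
  proof (rule sum.cong[OF refl])
    fix \<sigma>s
    have right: "cyclic_form (map dual_cochain \<sigma>s) (c * n) = (\<Sum>\<nu>\<in>simplices. cochain_val n \<nu> *
        cyclic_form (map dual_cochain \<sigma>s) (c * dual_cochain \<nu>))" for c
      by (rule functional_expansion[of "\<lambda>y. cyclic_form (map dual_cochain \<sigma>s) (c * y)"])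
        (simp only: distrib_left cyclic_form_add)
    have left: "cyclic_form (map dual_cochain \<sigma>s) (m * n) = (\<Sum>\<mu>\<in>simplices. cochain_val m \<mu> *
        cyclic_form (map dual_cochain \<sigma>s) (dual_cochain \<mu> * n))"
      by (rule functional_expansion[of "\<lambda>y. cyclic_form (map dual_cochain \<sigma>s) (y * n)"])
        (simp only: distrib_right cyclic_form_add)
    show "(\<Sum>\<mu>\<in>simplices. \<Sum>\<nu>\<in>simplices. ?P \<sigma>s * (cochain_val m \<mu> * (cochain_val n \<nu> *
        cyclic_form (map dual_cochain \<sigma>s) (dual_cochain \<mu> * dual_cochain \<nu>)))) =
        ?P \<sigma>s * cyclic_form (map dual_cochain \<sigma>s) (m * n)"
      by (subst left) (simp only: right sum_distrib_left)
  qed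
  also have "\<dots> = cyclic_form as (m * n)"
    by (rule multilinear_expansion[symmetric, of "\<lambda>as. cyclic_form as (m * n)"])
      (rule cyclic_form_add_list)
  finally show ?thesis using True by simp
qed (simp add: F_triangle_def)

section \<open>Multilinearity and boundary of the map of one triangle\<close>

lemma F_triangle_add_left:
  "t < length as \<Longrightarrow> F_triangle i j l (as[t := x + y]) m bs n =
    F_triangle i j l (as[t := x]) m bs n + F_triangle i j l (as[t := y]) m bs n"
  by (cases "bs = []") (simp_all only: F_triangle_eq_cyclic_form cyclic_form_add_list simp_thms if_True
      if_False add_0_right)

lemma F_triangle_add_middle:
  "F_triangle i j l as (x + y) bs n = F_triangle i j l as x bs n + F_triangle i j l as y bs n"
  by (cases "bs = []") (simp_all only: F_triangle_eq_cyclic_form distrib_right cyclic_form_add simp_thms if_True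
      if_False add_0_right)

lemma F_triangle_add_right:
  "t < length bs \<Longrightarrow> F_triangle i j l as m (bs[t := x + y]) n =
    F_triangle i j l as m (bs[t := x]) n + F_triangle i j l as m (bs[t := y]) n"
  by (cases "bs = []") (simp_all add: F_triangle_eq_cyclic_form)

lemma F_triangle_add_dual:
  "F_triangle i j l as m bs (x + y) = F_triangle i j l as m bs x + F_triangle i j l as m bs y"
  by (cases "bs = []") (simp_all only: F_triangle_eq_cyclic_form distrib_left cyclic_form_add simp_thms if_True
      if_False add_0_right)

lemma D_F_triangle:
  "tetrahedron.D (F_triangle i j l) as m bs n =
    edge_form {i, j} as m bs n + edge_form {i, l} as m bs n + edge_form {j, l} as m bs n"
proof (cases "bs = []")
  case True
  \<comment> \<open>The Leibniz rule merges the differentials of \<open>m\<close> and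
    \<open>n\<close> into that of the product.\<close>
  have d: "F_triangle i j l as (cochain_d m) [] n + F_triangle i j l as m [] (cochain_d n) =
      cyclic_form as (cochain_d (m * n))"
    by (simp only: F_triangle_eq_cyclic_form simp_thms if_True tetrahedron.leibniz cyclic_form_add)
  have "tetrahedron.D (F_triangle i j l) as m [] n =
      inner_terms (\<lambda>as. cyclic_form as (m * n)) as + cyclic_form as (cochain_d (m * n))
      + (if as = [] then 0 else cyclic_form (tl as) (m * n * hd as)
        + cyclic_form (butlast as) (last as * (m * n)))"
    unfolding tetrahedron.D_def inner_terms_def d[symmetric]
    by (cases "as = []") (simp_all only: F_triangle_eq_cyclic_form simp_thms if_True if_False
        mult.assoc list.size diff_0_eq_0 lessThan_0 sum.empty add_0_left add_0_right ac_simps)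
  also have "\<dots> = edge_form {i, j} as m [] n + edge_form {i, l} as m [] n + edge_form {j, l} as m [] n"
  proof (cases "as = []")
    case True
    then show ?thesis
      by (simp only: cyclic_form_Nil_d edge_form_def)
        (simp add: inner_terms_def)
  next
    case False
    then show ?thesis
      using hochschild_boundary_cyclic_form[OF False, of "m * n"]
      by (simp only: edge_form_def block_sum_singleton simp_thms if_True if_False)
  qed
  finally show ?thesis using True by simp
next
  case False
  then obtain b bs' where bs: "bs = b # bs'" by (cases bs) auto
  \<comment> \<open>For q = 1 only the terms with \<open>m * b\<close> and \<open>b * n\<close>
    survive, and they agree by associativity. For q > 1 every term still has a right argument and
    vanishes.\<close>
  have "tetrahedron.D (F_triangle i j l) as m bs n = 0"
  proof (cases bs')
    case Nil
    then show ?thesis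
      unfolding bs tetrahedron.D_def F_triangle_eq_cyclic_form
      by (simp add: mult.assoc bit_add_self)
  next
    case (Cons c cs)
    then have "tl bs \<noteq> []" "butlast bs \<noteq> []" "tetrahedron.mult_at bs t \<noteq> []" for t
      by (simp_all add: bs tetrahedron.mult_at_def)
    then show ?thesis
      using False unfolding tetrahedron.D_def F_triangle_eq_cyclic_form by simp
  qed
  then show ?thesis using False by (simp add: edge_form_def)
qed

end

section \<open>The homotopy inner product\<close>

lemma D_add: "tetrahedron.D (F + G) = tetrahedron.D F + tetrahedron.D G"
proof (intro ext)
  fix as m bs n
  show "tetrahedron.D (F + G) as m bs n = (tetrahedron.D F + tetrahedron.D G) as m bs n"
    unfolding tetrahedron.D_def plus_fun_apply
    by (cases "as = []"; cases "bs = []")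
      (simp_all only: simp_thms if_True if_False sum.distrib ac_simps add_0_left add_0_right)
qed

text \<open>Only finitely many degrees of the cochain algebra are nonzero, so every linear
  functional lies in the graded dual.\<close>

lemma graded_dualI:
  assumes add: "\<And>x y. f (x + y) = f x + f y"
  shows "f \<in> tetrahedron.graded_dual"
proof -
  have f0: "f 0 = 0" using add[of 0 0] by (metis add_0_left add_cancel_right_left)
  have "{k. \<exists>x\<in>cochain_grade k. f x \<noteq> 0} \<subseteq> (\<lambda>\<sigma>. 1 - int (card \<sigma>)) ` simplices"
  proof
    fix k assume "k \<in> {k. \<exists>x\<in>cochain_grade k. f x \<noteq> 0}"
    then obtain x where x: "x \<in> cochain_grade k" "x \<noteq> 0" using f0 by blast
    then obtain \<sigma> where "\<sigma> \<in> simplices" "cochain_val x \<sigma> \<noteq> 0"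
      using cochain_eqI[of x 0] by (metis zero_cochain.rep_eq)
    then show "k \<in> (\<lambda>\<sigma>. 1 - int (card \<sigma>)) ` simplices"
      using x(1) by (auto simp: cochain_grade_def)
  qed
  then have "finite {k. \<exists>x\<in>cochain_grade k. f x \<noteq> 0}"
    by (rule finite_subset) simp
  then show ?thesis
    using linear_functionalI[OF add] by (simp add: tetrahedron.graded_dual_def)
qed

theorem mainTheorem4:
  shows "tetrahedron.homotopy_inner_product
    (F_triangle 0 1 2 + F_triangle 0 1 3 + F_triangle 0 2 3 + F_triangle 1 2 3)"
proof -
  have lt: "(0::nat) < 1" "(0::nat) < 2" "(1::nat) < 2" "(1::nat) < 3" "(2::nat) < 3"
    "(2::nat) \<le> 3" "(3::nat) \<le> 3"
    by simp_all
  have "tetrahedron.map_family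
    (F_triangle 0 1 2 + F_triangle 0 1 3 + F_triangle 0 2 3 + F_triangle 1 2 3)"
    unfolding tetrahedron.map_family_def
    by (intro conjI allI impI graded_dualI linear_functionalI)
      (simp_all only: plus_fun_apply F_triangle_add_left F_triangle_add_middle F_triangle_add_right
        F_triangle_add_dual lt ac_simps)
  \<comment> \<open>The four triangles give twelve edge forms, two for each of the six
    edges.\<close>
  moreover have "tetrahedron.D
    (F_triangle 0 1 2 + F_triangle 0 1 3 + F_triangle 0 2 3 + F_triangle 1 2 3) = 0"
    by (intro ext) (simp only: D_add plus_fun_apply zero_fun_apply D_F_triangle lt mod_2_simps)
  ultimately show ?thesis
    by (simp only: tetrahedron.homotopy_inner_product_def)
qed

end
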